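(* Let $A=A^\top\in\mathbb{R}^{3\times 3}$ be such that $\mathrm{tr}(A)I-A$ is a symmetric positive definite matrix. Let $\mathcal{Q}\subset\mathbb{N}$ be an index set of finite cardinality greater than or equal to $2$. Let $u\in\mathbb{S}^2$ be a fixed unit vector, and consider the transformation $$\Gamma:SO(3)\times\mathcal{Q}\to SO(3),\qquad \Gamma(R,q)=R\,\mathcal{R}_a(\theta_q(R),u),$$ where $\theta_q:SO(3)\to\mathbb{R}$ is a (differentiable) real-valued function which is injective with respect to the index $q$ (that is, $p\neq q$ implies $\theta_p(R)-\theta_q(R)\neq 0$). Assume that $\det(\Theta(R,q))\neq 0$ for all $(R,q)\in SO(3)\times\mathcal{Q}$ and that $\Gamma^{-1}(\{I\})=\{I\}\times\mathcal{Q}$. Then the potential function $$\mathcal{U}(R,q):=V_A(\Gamma(R,q))=\mathrm{tr}\big(A(I-\Gamma(R,q))\big)$$ is synergistic if and only if $$\Delta(v,u)>0\quad\text{for all } v\in\mathcal{E}(A).$$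
   Context: Notation. $I$ is the $3\times3$ identity; $\mathfrak{so}(3)$ is the space of skew-symmetric $3\times 3$ matrices; $[\omega]_\times\in\mathfrak{so}(3)$ is defined by $[\omega]_\times x=\omega\times x$, and $\mathrm{vex}:\mathfrak{so}(3)\to\mathbb{R}^3$ is the inverse of $\omega\mapsto[\omega]_\times$. $\psi(M)=\mathrm{vex}((M-M^\top)/2)$ for $M\in\mathbb{R}^{3\times3}$. $\mathcal{R}_a(\theta,u)=e^{\theta[u]_\times}=I+\sin\theta\,[u]_\times+(1-\cos\theta)[u]_\times^2$ for $\theta\in\mathbb{R}$, $u\in\mathbb{S}^2$ (the unit sphere of $\mathbb{R}^3$). $SO(3)$ carries the Riemannian metric $\langle R\Omega_1,R\Omega_2\rangle_R=\mathrm{tr}(\Omega_1^\top\Omega_2)$, $\Omega_1,\Omega_2\in\mathfrak{so}(3)$, and $\nabla$ denotes the gradient with respect to $R$ relative to this metric. $V_A(R)=\mathrm{tr}(A(I-R))$ and $W=\mathrm{tr}(A)I-A$. $\Gamma^{-1}(S)$ is the preimage of $S\subseteq SO(3)$ in $SO(3)\times\mathcal{Q}$. Further, $$\Theta(R,q)=\mathcal{R}_a(\theta_q(R),u)^\top+2u\,\psi(R^\top\nabla\theta_q(R))^\top .$$ Synergism. Let $\mathcal{A}=\{I\}\times\mathcal{Q}$. $\mathcal{P}(\mathcal{A})$ is the set of potential functions with respect to $\mathcal{A}$: continuously differentiable functions $\mathcal{U}:SO(3)\times\mathcal{Q}\to[0,\infty)$ (that is to say, for each $q\in\mathcal{Q}$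 the map $R\mapsto\mathcal{U}(R,q)$ is continuous and differentiable on $SO(3)$) with $\mathcal{U}(R,q)=0$ for all $(R,q)\in\mathcal{A}$ and $\mathcal{U}(R,q)>0$ for all $(R,q)\notin\mathcal{A}$. $\Psi_{\mathcal{U}}\subset SO(3)\times\mathcal{Q}$ is the set of critical points of $\mathcal{U}$, i.e. of $(R,q)$ with $\nabla\mathcal{U}(R,q)=0$. A function $\mathcal{U}\in\mathcal{P}(\mathcal{A})$ is (centrally) synergistic if and only if there exists a constant $\delta>0$ such that $$\bar\delta:=\min_{(R,q)\in\Psi_{\mathcal{U}}\setminus\mathcal{A}}\Big[\mathcal{U}(R,q)-\min_{p\in\mathcal{Q}}\mathcal{U}(R,p)\Big]>\delta .$$ The quantity $\Delta(v,u)$. $\mathcal{E}(A)$ is the set of real unit eigenvectors of $A$; $\{v_1,v_2,v_3\}$ is an orthonormal eigenbasis of $A$, where $v_i$ is a unit eigenvector associated to the eigenvalue $\lambda_i^A$; $\lambda_i^W=\mathrm{tr}(A)-\lambda_i^A$ is the eigenvalue of $W$ associated to $v_i$; for $v\in\mathcal{E}(A)=\mathcal{E}(W)$, $\lambda^W$ is the eigenvalue of $W$ associated to $v$; $\angle(x,y)$ is the angle between $x$ and $y$. $\Delta(v,u)$ is computed as follows (eigenvectors $v_i$ being listed up to sign, with $\Delta(-v,u)=\Delta(v,u)$). (1) If $A=\lambda I$ ($\lambda_i^A=\lambda$, $i=1,2,3$), then $\mathcal{E}(A)=\mathbb{S}^2$ and $\Delta(v,u)=\lambda^W\cos^2\phi$,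 $\phi=\angle(u,v)$. (2) If $A$ has two distinct eigenvalues $\lambda_1^A=\lambda_2^A\neq\lambda_3^A$, then $\mathcal{E}(A)$ consists of $v_3$ and all $v_{12}\in\mathrm{span}\{v_1,v_2\}\cap\mathbb{S}^2$, and $\Delta(v_{12},u)=(1-(u^\top v_3)^2)\,[\lambda_2^W-\lambda_3^W\sin^2\phi]$, $\Delta(v_3,u)=\lambda_3^W-\lambda_2^W(1-(u^\top v_3)^2)$, where $\phi=\angle(v_{12},u^\bot)$ and $u^\bot$ is the projection of $u$ on the plane $\mathrm{span}\{v_1,v_2\}$. (3) If $A$ has three distinct eigenvalues $0<\lambda_1^A<\lambda_2^A<\lambda_3^A$, then $\mathcal{E}(A)=\{v_1,v_2,v_3\}$ and $\Delta(v_1,u)=\lambda_1^W-(u^\top v_2)^2\lambda_3^W-(u^\top v_3)^2\lambda_2^W$, $\Delta(v_2,u)=\lambda_2^W-(u^\top v_3)^2\lambda_1^W-(u^\top v_1)^2\lambda_3^W$, $\Delta(v_3,u)=\lambda_3^W-(u^\top v_1)^2\lambda_2^W-(u^\top v_2)^2\lambda_1^W$.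
   Formalization: Injectivity in q is strengthened: for R≠I and p≠q, θ_p(R)−θ_q(R) must not be a multiple of 2π (at R=I it need only be nonzero). As printed the "if" part fails, e.g. for constants θ_0=0, θ_1=2π; the "only if" part, which does not need this, is also stated under it. *)

theory Defs
  imports "HOL-Analysis.Analysis"
begin

type_synonym mat3 = "real^3^3"

definition SO3 :: "mat3 set" where
  "SO3 = {R. rotation_matrix R}"

definition so3 :: "mat3 set" where
  "so3 = {M. transpose M = - M}"

definition hat :: "real^3 \<Rightarrow> mat3" where
  "hat w = matrix (cross3 w)"

definition vex :: "mat3 \<Rightarrow> real^3" where
  "vex = inv hat"

definition psi :: "mat3 \<Rightarrow> real^3" where
  "psi M = vex ((1/2) *\<^sub>R (M - transpose M))"

text \<open>Rodrigues' formula for the matrix exponential of \<open>t *\<^sub>R hat u\<close>, with \<open>u\<close> a unit vector.\<close>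

definition Ra :: "real \<Rightarrow> real^3 \<Rightarrow> mat3" where
  "Ra t u = mat 1 + sin t *\<^sub>R hat u + (1 - cos t) *\<^sub>R (hat u ** hat u)"

text \<open>The metric is \<open>\<langle>R \<Omega>\<^sub>1, R \<Omega>\<^sub>2\<rangle> = tr (\<Omega>\<^sub>1\<^sup>T \<Omega>\<^sub>2)\<close> on the tangent space
  \<open>{R ** \<Omega> | \<Omega> \<in> so3}\<close> at \<open>R\<close>; for a rotation \<open>R\<close> and tangent vector \<open>X\<close> the
  corresponding \<open>\<Omega>\<close> is \<open>transpose R ** X\<close>.\<close>

definition tangent_SO3 :: "mat3 \<Rightarrow> mat3 set" where
  "tangent_SO3 R = {R ** W | W. W \<in> so3}"

definition metric_SO3 :: "mat3 \<Rightarrow> mat3 \<Rightarrow> mat3 \<Rightarrow> real" where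
  "metric_SO3 R X Y = trace (transpose (transpose R ** X) ** (transpose R ** Y))"

text \<open>Differentiability on the submanifold \<open>SO3\<close> is Frechet differentiability within the
  set \<open>SO3\<close>. A derivative \<open>f'\<close> at \<open>R\<close> within \<open>SO3\<close> is determined only on the
  tangent space at \<open>R\<close>, and the gradient depends on nothing else.\<close>

definition has_gradient_SO3 :: "(mat3 \<Rightarrow> real) \<Rightarrow> mat3 \<Rightarrow> mat3 \<Rightarrow> bool" where
  "has_gradient_SO3 f R G \<longleftrightarrow> G \<in> tangent_SO3 R \<and>
     (\<exists>f'. (f has_derivative f') (at R within SO3) \<and>
           (\<forall>X \<in> tangent_SO3 R. f' X = metric_SO3 R G X))"

definition grad_SO3 :: "(mat3 \<Rightarrow> real) \<Rightarrow> mat3 \<Rightarrow> mat3" where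
  "grad_SO3 f R = (THE G. has_gradient_SO3 f R G)"

definition symmetric_positive_definite :: "mat3 \<Rightarrow> bool" where
  "symmetric_positive_definite M \<longleftrightarrow>
     transpose M = M \<and> (\<forall>x. x \<noteq> 0 \<longrightarrow> 0 < x \<bullet> (M *v x))"

definition V :: "mat3 \<Rightarrow> mat3 \<Rightarrow> real" where
  "V A R = trace (A ** (mat 1 - R))"

definition Gamma_map :: "(nat \<Rightarrow> mat3 \<Rightarrow> real) \<Rightarrow> real^3 \<Rightarrow> mat3 \<times> nat \<Rightarrow> mat3" where
  "Gamma_map \<theta> u = (\<lambda>(R, q). R ** Ra (\<theta> q R) u)"

definition Theta :: "(nat \<Rightarrow> mat3 \<Rightarrow> real) \<Rightarrow> real^3 \<Rightarrow> mat3 \<times> nat \<Rightarrow> mat3" where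
  "Theta \<theta> u = (\<lambda>(R, q). transpose (Ra (\<theta> q R) u) +
     2 *\<^sub>R ((columnvector u :: real^1^3) ** rowvector (psi (transpose R ** grad_SO3 (\<theta> q) R))))"

definition potential_functions ::
    "nat set \<Rightarrow> (mat3 \<times> nat) set \<Rightarrow> (mat3 \<times> nat \<Rightarrow> real) set" where
  "potential_functions Q S = {U.
     (\<forall>x \<in> SO3 \<times> Q. 0 \<le> U x) \<and>
     (\<forall>q \<in> Q. continuous_on SO3 (\<lambda>R. U (R, q)) \<and> (\<lambda>R. U (R, q)) differentiable_on SO3) \<and>
     (\<forall>x \<in> S. U x = 0) \<and>
     (\<forall>x \<in> SO3 \<times> Q - S. 0 < U x)}"

definition critical_points :: "nat set \<Rightarrow> (mat3 \<times> nat \<Rightarrow> real) \<Rightarrow> (mat3 \<times> nat) set" where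
  "critical_points Q U = {(R, q) \<in> SO3 \<times> Q. grad_SO3 (\<lambda>R'. U (R', q)) R = 0}"

definition is_minimum :: "real \<Rightarrow> real set \<Rightarrow> bool" where
  "is_minimum m S \<longleftrightarrow> m \<in> S \<and> (\<forall>s \<in> S. m \<le> s)"

text \<open>The outer minimum ranges over a possibly infinite set of critical points, so it is required
  to be attained (the library's \<open>Min\<close> is meaningful for finite sets only).\<close>

definition synergistic :: "nat set \<Rightarrow> (mat3 \<times> nat \<Rightarrow> real) \<Rightarrow> bool" where
  "synergistic Q U \<longleftrightarrow> U \<in> potential_functions Q ({mat 1} \<times> Q) \<and>
     (\<exists>\<delta>>0. \<exists>\<delta>bar.
        is_minimum \<delta>bar ((\<lambda>(R, q). U (R, q) - Min ((\<lambda>p. U (R, p)) ` Q)) `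
                          (critical_points Q U - {mat 1} \<times> Q)) \<and>
        \<delta> < \<delta>bar)"

definition unit_eigenvectors :: "mat3 \<Rightarrow> (real^3) set" where
  "unit_eigenvectors A = {v. norm v = 1 \<and> (\<exists>c. A *v v = c *\<^sub>R v)}"

definition angle :: "real^3 \<Rightarrow> real^3 \<Rightarrow> real" where
  "angle x y = arccos (x \<bullet> y / (norm x * norm y))"

text \<open>An orthonormal eigenbasis \<open>b 1, b 2, b 3\<close> of \<open>A\<close> with eigenvalues \<open>l 1, l 2, l 3\<close>,
  labelled so that a double eigenvalue comes first and three distinct ones are increasing.\<close>

definition labelled_eigenbasis :: "mat3 \<Rightarrow> (3 \<Rightarrow> real) \<Rightarrow> (3 \<Rightarrow> real^3) \<Rightarrow> bool" where
  "labelled_eigenbasis A l b \<longleftrightarrow>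
     (\<forall>i j. b i \<bullet> b j = (if i = j then 1 else 0)) \<and>
     (\<forall>i. A *v b i = l i *\<^sub>R b i) \<and>
     ((l 1 = l 2 \<and> l 2 = l 3) \<or> (l 1 = l 2 \<and> l 2 \<noteq> l 3) \<or> (l 1 < l 2 \<and> l 2 < l 3))"

text \<open>\<open>Delta A l b v u\<close> is meaningful for \<open>labelled_eigenbasis A l b\<close> and
  \<open>v \<in> unit_eigenvectors A\<close>. Such a \<open>v\<close> is, for a double eigenvalue, either in
  \<open>span {b 1, b 2}\<close> or \<open>\<plusminus> b 3\<close>, and, for distinct eigenvalues, one of the
  \<open>\<plusminus> b i\<close>, so the final \<open>else\<close> branches concern \<open>\<plusminus> b 3\<close>. If \<open>u\<close> is parallel to
  \<open>b 3\<close>, its projection \<open>uperp\<close> vanishes and so does the factor in front of the bracket,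
  so the value of the angle does not matter.\<close>

definition Delta :: "mat3 \<Rightarrow> (3 \<Rightarrow> real) \<Rightarrow> (3 \<Rightarrow> real^3) \<Rightarrow> real^3 \<Rightarrow> real^3 \<Rightarrow> real" where
  "Delta A l b v u =
    (let lW = (\<lambda>i. trace A - l i);
         uperp = (u \<bullet> b 1) *\<^sub>R b 1 + (u \<bullet> b 2) *\<^sub>R b 2
     in
     if l 1 = l 2 \<and> l 2 = l 3 then
       lW 1 * (cos (angle u v))\<^sup>2
     else if l 1 = l 2 then
       (if v \<in> span {b 1, b 2} then
          (1 - (u \<bullet> b 3)\<^sup>2) * (lW 2 - lW 3 * (sin (angle v uperp))\<^sup>2)
        else
          lW 3 - lW 2 * (1 - (u \<bullet> b 3)\<^sup>2))
     else
       (if v = b 1 \<or> v = - b 1 then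
          lW 1 - (u \<bullet> b 2)\<^sup>2 * lW 3 - (u \<bullet> b 3)\<^sup>2 * lW 2
        else if v = b 2 \<or> v = - b 2 then
          lW 2 - (u \<bullet> b 3)\<^sup>2 * lW 1 - (u \<bullet> b 1)\<^sup>2 * lW 3
        else
          lW 3 - (u \<bullet> b 1)\<^sup>2 * lW 2 - (u \<bullet> b 2)\<^sup>2 * lW 1))"

end

(* In the left trivialisation, the differential of R |-> Gamma(R,q) is Theta(R,q), so invertibility of
   Theta makes the critical points of U those (R,q) for which A Gamma(R,q) is symmetric. For W positive
   definite this forces Gamma(R,q) to be the identity or a half turn Ra(pi,v) about a unit eigenvector v
   of A. Changing the index from q to p multiplies Gamma(R,q) by Ra(s,u), s = theta_p(R) - theta_q(R), and

     V(Ra(pi,v)) - V(Ra(pi,v) Ra(s,u)) = (1 - cos s) Delta(v,u),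

   so the gap at a critical point is positive iff Delta(v,u) > 0. Every half turn Ra(pi,v) does occur,
   because Gamma(.,q) is onto: for P in SO(3), the maximum over R of tr(P^T Gamma(R,q)) is a critical
   value, hence 3 or -1. The minimum of the gap is attained since the critical set is compact. *)

theory Submission
  imports Defs
begin

section \<open>Skew matrices and the hat map\<close>

lemma hat_nth:
  "hat w $ 1 $ 1 = 0" "hat w $ 1 $ 2 = - w$3" "hat w $ 1 $ 3 = w$2"
  "hat w $ 2 $ 1 = w$3" "hat w $ 2 $ 2 = 0" "hat w $ 2 $ 3 = - w$1"
  "hat w $ 3 $ 1 = - w$2" "hat w $ 3 $ 2 = w$1" "hat w $ 3 $ 3 = 0"
  by (simp_all add: hat_def matrix_def cross3_simps axis_def)

lemmas mat3_simps = vec_eq_iff forall_3 sum_3 matrix_matrix_mult_def matrix_vector_mult_def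
  transpose_def trace_def mat_def inner_vec_def hat_nth

lemma hat_mv: "hat w *v x = cross3 w x"
  by (simp add: mat3_simps cross3_simps)

lemma transpose_hat: "transpose (hat w) = - hat w"
  by (simp add: mat3_simps)

lemma linear_hat: "linear hat"
  by (rule linearI) (simp_all add: mat3_simps)

lemma inj_hat: "inj hat"
  by (rule injI) (simp add: mat3_simps)

lemma hat_eq_0_iff: "hat w = 0 \<longleftrightarrow> w = 0"
  using inj_hat linear_hat linear_injective_0 linear_0 by metis

lemma so3_eq_range_hat: "so3 = range hat"
proof (rule set_eqI, rule iffI)
  fix M :: mat3 assume "M \<in> so3"
  then have "M $ j $ i = - M $ i $ j" for i j
    by (metis (mono_tags) so3_def mem_Collect_eq transpose_def vec_lambda_beta vector_uminus_component)
  from this[of 1 1] this[of 1 2] this[of 1 3] this[of 2 2] this[of 2 3] this[of 3 3]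
  have "M = hat (vector [M$3$2, M$1$3, M$2$1])"
    unfolding vec_eq_iff forall_3 hat_nth vector_3 by linarith
  then show "M \<in> range hat" by blast
qed (auto simp: so3_def transpose_hat)

lemma vex_hat: "vex (hat w) = w"
  by (simp add: vex_def inv_f_f inj_hat)

lemma psi_hat: "psi (hat w) = w"
  by (simp add: psi_def transpose_hat vex_hat scaleR_2 [symmetric])

lemma tangent_SO3_eq: "tangent_SO3 R = range (\<lambda>w. R ** hat w)"
  by (auto simp: tangent_SO3_def so3_eq_range_hat)

lemma trace_hat_hat: "trace (transpose (hat v) ** hat w) = 2 * (v \<bullet> w)"
  by (simp add: mat3_simps)

lemma symmetric_mat3_iff: fixes M::mat3 shows "transpose M = M \<longleftrightarrow> M$1$2 = M$2$1 \<and> M$1$3 = M$3$1 \<and> M$2$3 = M$3$2"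
  unfolding vec_eq_iff forall_3 transpose_def vec_lambda_beta by metis
lemma trace_mult_hat: "trace (M ** hat w) = w$1 * (M$2$3 - M$3$2) + w$2 * (M$3$1 - M$1$3) + w$3 * (M$1$2 - M$2$1)"
  by (simp add: mat3_simps algebra_simps)
text \<open>For the trace pairing, the symmetric matrices are the orthogonal complement of the skew
  ones. This is how vanishing derivatives become symmetry conditions; the three coordinate axes
  suffice as test vectors.\<close>

lemma trace_mult_hat_eq_0_iff: "(\<forall>w. trace (M ** hat w) = 0) \<longleftrightarrow> transpose M = M"
proof
  assume "\<forall>w. trace (M ** hat w) = 0"
  then have "trace (M ** hat (axis i 1)) = 0" for i by blast
  from this[of 1] this[of 2] this[of 3] show "transpose M = M"
    by (simp add: trace_mult_hat symmetric_mat3_iff axis_def)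
qed (simp add: trace_mult_hat symmetric_mat3_iff)

text \<open>In axis coordinates, anticommuting a skew matrix with \<open>A\<close> is multiplication
  by W. Hypotheses on W enter the study of critical points through this identity.\<close>

lemma anticommutator_hat:
  assumes "transpose A = A"
  shows "A ** hat k + hat k ** A = hat ((trace A *\<^sub>R mat 1 - A) *v k)"
  using assms unfolding symmetric_mat3_iff by (simp add: mat3_simps algebra_simps)

lemma hat_cubed: "hat u ** (hat u ** hat u) = - (u \<bullet> u) *\<^sub>R hat u"
  by (simp add: mat3_simps algebra_simps)

section \<open>Rotations and Rodrigues' formula\<close>

lemma SO3_iff: "R \<in> SO3 \<longleftrightarrow> transpose R ** R = mat 1 \<and> R ** transpose R = mat 1 \<and> det R = 1"
  by (auto simp: SO3_def rotation_matrix_def orthogonal_matrix_def)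

lemma mat_1_in_SO3: "mat 1 \<in> SO3"
  by (simp add: SO3_iff)

lemma mult_in_SO3: "R \<in> SO3 \<Longrightarrow> S \<in> SO3 \<Longrightarrow> R ** S \<in> SO3"
  by (simp add: SO3_def rotation_matrix_def orthogonal_matrix_mul det_mul)

lemma transpose_in_SO3: "R \<in> SO3 \<Longrightarrow> transpose R \<in> SO3"
  by (auto simp: SO3_iff)

text \<open>Rotations preserve the cross product, so conjugating a skew matrix by a rotation rotates
  its axis vector. It moves tangent vectors from the left to the right of \<open>G\<close>.\<close>

lemma hat_mult_SO3:
  assumes "G \<in> SO3"
  shows "hat w ** G = G ** hat (transpose G *v w)"
proof -
  have w: "G *v (transpose G *v w) = w"
    using assms by (simp only: SO3_iff matrix_vector_mul_assoc matrix_vector_mul_lid)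
  have "(hat w ** G) *v x = (G ** hat (transpose G *v w)) *v x" for x
  proof -
    have "(G ** hat (transpose G *v w)) *v x = G *v cross3 (transpose G *v w) x"
      by (simp add: hat_mv flip: matrix_vector_mul_assoc)
    also have "\<dots> = cross3 (G *v (transpose G *v w)) (G *v x)"
      using assms by (simp add: cross_rotation_matrix SO3_def)
    also have "\<dots> = (hat w ** G) *v x"
      by (simp only: w hat_mv flip: matrix_vector_mul_assoc)
    finally show ?thesis by simp
  qed
  then show ?thesis by (simp add: matrix_eq)
qed

lemma bounded_bilinear_mat3_mult: "bounded_bilinear ((**) :: mat3 \<Rightarrow> mat3 \<Rightarrow> mat3)"
  unfolding bilinear_conv_bounded_bilinear [symmetric] bilinear_def
  by (auto intro!: linearI simp: matrix_add_ldistrib matrix_matrix_mult_def vec_eq_iff sum.distrib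
      sum_distrib_left algebra_simps)

interpretation mat3_mult: bounded_bilinear "(**) :: mat3 \<Rightarrow> mat3 \<Rightarrow> mat3"
  by (rule bounded_bilinear_mat3_mult)

text \<open>For a unit axis the cube of \<open>hat u\<close> is \<open>- hat u\<close>, so
  \<open>mat 1\<close>, \<open>hat u\<close> and \<open>hat u ** hat u\<close> span an algebra;
  comparing coefficients leaves the addition formulas of sine and cosine.\<close>

lemma Ra_mult:
  assumes "norm u = 1"
  shows "Ra s u ** Ra t u = Ra (s + t) u"
proof -
  define K2 where "K2 = hat u ** hat u"
  have c: "hat u ** K2 = - hat u" 
    using assms hat_cubed[of u] by (simp add: K2_def norm_eq_1)
  then have c': "K2 ** hat u = - hat u" by (simp add: K2_def matrix_mul_assoc)
  then have c4: "K2 ** K2 = - K2"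
    by (metis K2_def matrix_mul_assoc mat3_mult.minus_left)
  have "Ra s u ** Ra t u = mat 1 + (sin s * cos t + cos s * sin t) *\<^sub>R hat u
      + (1 - (cos s * cos t - sin s * sin t)) *\<^sub>R K2"
    unfolding Ra_def K2_def[symmetric]
    by (simp add: mat3_mult.add_left mat3_mult.add_right mat3_mult.scaleR_left mat3_mult.scaleR_right c c' c4 
      K2_def[symmetric]) (simp add: algebra_simps)
  then show ?thesis by (simp add: Ra_def K2_def sin_add cos_add)
qed

lemma transpose_Ra: "transpose (Ra t u) = Ra (- t) u"
  by (simp add: Ra_def mat3_simps algebra_simps)

lemma Ra_0: "Ra 0 u = mat 1"
  by (simp add: Ra_def)

lemma Ra_in_SO3:
  assumes "norm u = 1"
  shows "Ra t u \<in> SO3"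
proof -
  have o: "transpose (Ra t u) ** Ra t u = mat 1" "Ra t u ** transpose (Ra t u) = mat 1" for t
    by (simp_all add: transpose_Ra Ra_mult[OF assms] Ra_0)
  \<comment> \<open>Being the square of a rotation by half the angle excludes determinant
    -1.\<close>
  have "det (Ra t u) = det (Ra (t/2) u) * det (Ra (t/2) u)"
    by (simp add: Ra_mult[OF assms] flip: det_mul)
  then have "det (Ra t u) \<ge> 0" by simp
  moreover have "det (Ra t u) = 1 \<or> det (Ra t u) = - 1"
    by (rule det_orthogonal_matrix) (simp add: orthogonal_matrix_def o)
  ultimately show ?thesis using o by (auto simp: SO3_iff)
qed

section \<open>Symmetric rotations and half turns\<close>

lemma inner_mat3_mv: "(M *v x) \<bullet> y = x \<bullet> (transpose M *v y)" for M :: mat3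
  by (simp add: mat3_simps algebra_simps)

lemma SO3_inner: "G \<in> SO3 \<Longrightarrow> (G *v x) \<bullet> (G *v y) = x \<bullet> y"
  by (simp only: inner_mat3_mv matrix_vector_mul_assoc SO3_iff matrix_vector_mul_lid)

text \<open>A displacement \<open>G *v x - x\<close> is orthogonal to every fixed vector of
  \<open>G\<close>. The cross product of \<open>v\<close> and \<open>z\<close> is fixed as well, so
  the displacement is orthogonal to three independent vectors.\<close>

lemma SO3_fixing_two_orthogonal:
  assumes G: "G \<in> SO3" and fix_v: "G *v v = v" and fix_z: "G *v z = z"
    and orth: "v \<bullet> z = 0" and nz: "v \<noteq> 0" "z \<noteq> 0"
  shows "G = mat 1"
proof -
  have "G *v x = mat 1 *v x" for x
  proof -
    define y where "y = G *v x - x"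
    have y: "y \<bullet> w = 0" if "G *v w = w" for w
      using SO3_inner[OF G, of x w] that by (simp add: y_def inner_diff_left)
    have fix_c: "G *v cross3 v z = cross3 v z"
      using G fix_v fix_z cross_rotation_matrix[of G v z] by (simp add: SO3_def)
    have "cross3 y (cross3 v z) = 0"
      using y[OF fix_v] y[OF fix_z] by (simp add: Lagrange)
    moreover have "cross3 v z \<noteq> 0"
      using orth nz norm_and_cross_eq_0 by blast
    ultimately have "y = 0" using y[OF fix_c] norm_and_cross_eq_0 by blast
    then show ?thesis by (simp add: y_def)
  qed
  then show ?thesis by (simp add: matrix_eq)
qed

lemma Ra_pi_mv:
  assumes "norm v = 1" shows "Ra pi v *v x = (2 * (v \<bullet> x)) *\<^sub>R v - x"
proof -
  have "Ra pi v *v x = x + 2 *\<^sub>R (hat v *v (hat v *v x))"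
    by (simp add: Ra_def matrix_vector_mult_add_rdistrib scaleR_matrix_vector_assoc matrix_vector_mul_assoc)
  also have "hat v *v (hat v *v x) = (v \<bullet> x) *\<^sub>R v - x"
    using assms by (simp add: hat_mv Lagrange norm_eq_1)
  finally show ?thesis by (simp add: algebra_simps scaleR_2)
qed

lemma trace_Ra: "trace (Ra t u) = 3 - 2 * (1 - cos t) * (u \<bullet> u)"
  by (simp add: Ra_def mat3_simps algebra_simps)

text \<open>A symmetric rotation is an involution, and its determinant excludes
  \<open>- mat 1\<close>; so some \<open>G *v x + x\<close> is nonzero, and it is fixed by
  \<open>G\<close>. Normalised, it is the axis \<open>v\<close>. For any \<open>y\<close>, the part
  of \<open>y + G *v y\<close> orthogonal to \<open>v\<close> is fixed too, hence zero unless
  \<open>G\<close> is the identity; this is the half turn formula.\<close>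

lemma symmetric_SO3_cases:
  assumes G: "G \<in> SO3" "transpose G = G"
  shows "G = mat 1 \<or> (\<exists>v. norm v = 1 \<and> G = Ra pi v)"
proof (cases "G = mat 1")
  case False
  have GG: "G *v (G *v x) = x" for x
    using G by (simp add: matrix_vector_mul_assoc SO3_iff)
  have "G \<noteq> - mat 1"
  proof
    assume "G = - mat 1"
    then have "det G = - 1" by (simp add: det_3 mat_def)
    then show False using G by (simp add: SO3_iff)
  qed
  then obtain x where x: "G *v x + x \<noteq> 0"
    by (metis matrix_eq add_eq_0_iff2 matrix_vector_mul_lid scaleR_matrix_vector_assoc scaleR_minus1_left)
  define v where "v = (1 / norm (G *v x + x)) *\<^sub>R (G *v x + x)"
  have v: "norm v = 1" using x by (simp add: v_def)
  have Gv: "G *v v = v"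
    by (simp add: v_def matrix_vector_mult_scaleR matrix_vector_right_distrib GG add.commute)
  have "G *v y = Ra pi v *v y" for y
  proof -
    define z where "z = y + G *v y - (2 * (v \<bullet> y)) *\<^sub>R v"
    have "G *v z = z"
      by (simp add: z_def matrix_vector_mult_scaleR matrix_vector_right_distrib
          matrix_vector_mult_diff_distrib GG Gv)
    moreover have "v \<bullet> z = 0"
      using v SO3_inner[OF G(1), of v y] by (simp add: z_def Gv inner_diff_right inner_add_right norm_eq_1)
    ultimately have "z = 0"
      using SO3_fixing_two_orthogonal[OF G(1) Gv] False v by force
    then show ?thesis by (simp add: z_def Ra_pi_mv[OF v] algebra_simps)
  qed
  then have "G = Ra pi v" by (simp add: matrix_eq)
  then show ?thesis using v by blast
qed simp

section \<open>Rotations \<open>G\<close> for which \<open>A ** G\<close> is symmetric\<close>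

lemma symmetric_SO3_if_symmetric_mult:
  assumes A: "transpose A = A" and W: "symmetric_positive_definite (trace A *\<^sub>R mat 1 - A)"
    and G: "G \<in> SO3" and AG: "transpose (A ** G) = A ** G"
  shows "transpose G = G"
proof -
  have 1: "transpose G ** A = A ** G"
    using AG A by (simp add: matrix_transpose_mul)
  text \<open>Subtracting (2) from (1), \<open>A\<close> anticommutes with the skew part of \<open>G\<close>.\<close>
  have "A ** transpose G = G ** (transpose G ** A) ** transpose G"
    using G by (simp add: matrix_mul_assoc SO3_iff)
  also have "\<dots> = G ** A"
    using G by (simp add: 1 SO3_iff flip: matrix_mul_assoc)
  finally have 2: "A ** transpose G = G ** A" .
  have "transpose (G - transpose G) = - (G - transpose G)"
    by (simp add: mat3_simps)
  then obtain k where k: "G - transpose G = hat k"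
    using so3_eq_range_hat unfolding so3_def by blast
  have "A ** hat k + hat k ** A = 0"
    using 1 2 by (simp add: mat3_mult.diff_left mat3_mult.diff_right flip: k)
  \<comment> \<open>The anticommutator is W acting on \<open>k\<close>, and a positive definite
    matrix has trivial kernel.\<close>
  then have "(trace A *\<^sub>R mat 1 - A) *v k = 0"
    by (simp add: anticommutator_hat[OF A] hat_eq_0_iff)
  then have "k = 0"
    using W unfolding symmetric_positive_definite_def by (metis inner_zero_right less_irrefl)
  then have "hat k = 0" by (simp add: hat_eq_0_iff)
  then show ?thesis using k by simp
qed

text \<open>A half turn about \<open>v\<close> is twice the projection onto \<open>v\<close> minus
  the identity, and \<open>A\<close> scales that projection by \<open>c\<close>. In this form
  symmetry and trace can be read off.\<close>

lemma mult_Ra_pi_unit_eigenvector: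
  assumes v: "norm v = 1" and Av: "A *v v = c *\<^sub>R v"
  shows "A ** Ra pi v = (2 * c) *\<^sub>R ((columnvector v :: real^1^3) ** rowvector v) - A"
proof -
  have "((columnvector v :: real^1^3) ** rowvector v) *v x = (v \<bullet> x) *\<^sub>R v" for x
    by (simp add: mat3_simps columnvector_def rowvector_def algebra_simps)
  then show ?thesis
    by (simp add: matrix_eq Ra_pi_mv[OF v] Av matrix_vector_mult_diff_distrib matrix_vector_mult_scaleR
      matrix_vector_mult_diff_rdistrib algebra_simps flip: matrix_vector_mul_assoc scaleR_matrix_vector_assoc)
qed

lemma symmetric_mult_SO3_iff:
  assumes A: "transpose A = A" and W: "symmetric_positive_definite (trace A *\<^sub>R mat 1 - A)"
    and G: "G \<in> SO3"
  shows "transpose (A ** G) = A ** G \<longleftrightarrow> G = mat 1 \<or> (\<exists>v\<in>unit_eigenvectors A. G = Ra pi v)"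
proof
  assume AG: "transpose (A ** G) = A ** G"
  have Gt: "transpose G = G"
    by (rule symmetric_SO3_if_symmetric_mult[OF assms AG])
  show "G = mat 1 \<or> (\<exists>v\<in>unit_eigenvectors A. G = Ra pi v)"
  proof (cases "G = mat 1")
    case False
    then obtain v where v: "norm v = 1" "G = Ra pi v"
      using symmetric_SO3_cases[OF G Gt] by blast
    have Gv: "G *v v = v"
      using v by (simp add: Ra_pi_mv norm_eq_1 scaleR_2)
    have "A ** G = G ** A"
      using AG A Gt by (simp add: matrix_transpose_mul)
    then have GA: "G *v (A *v v) = A *v v"
      by (metis Gv matrix_vector_mul_assoc)
    \<comment> \<open>Since \<open>G\<close> commutes with \<open>A\<close>, it fixes
      \<open>A *v v\<close>. A fixed component of \<open>A *v v\<close> orthogonal to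
      \<open>v\<close> would make \<open>G\<close> the identity, so \<open>A *v v\<close> is a
      multiple of \<open>v\<close>.\<close>
    define z where "z = A *v v - (v \<bullet> (A *v v)) *\<^sub>R v"
    have "G *v z = z"
      by (simp add: z_def GA Gv matrix_vector_mult_diff_distrib matrix_vector_mult_scaleR)
    moreover have "v \<bullet> z = 0"
      using v by (simp add: z_def inner_diff_right norm_eq_1)
    ultimately have "z = 0"
      using SO3_fixing_two_orthogonal[OF G Gv] False v by force
    then have "v \<in> unit_eigenvectors A"
      using v by (auto simp: z_def unit_eigenvectors_def)
    with v show ?thesis by blast
  qed simp
next
  assume "G = mat 1 \<or> (\<exists>v\<in>unit_eigenvectors A. G = Ra pi v)"
  then show "transpose (A ** G) = A ** G"
  proof
    assume "\<exists>v\<in>unit_eigenvectors A. G = Ra pi v"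
    then obtain v c where v: "norm v = 1" "A *v v = c *\<^sub>R v" "G = Ra pi v"
      by (auto simp: unit_eigenvectors_def)
    show ?thesis
      using A unfolding v(3) mult_Ra_pi_unit_eigenvector[OF v(1,2)] by (simp add: symmetric_mat3_iff columnvector_def
        rowvector_def matrix_matrix_mult_def)
  qed (simp add: A)
qed

text \<open>The matrix \<open>M\<close> is symmetric, so the sine term of Rodrigues' formula has
  trace zero against it. Only the \<open>1 - cos s\<close> term survives, where
  \<open>hat u ** hat u\<close> is the projection onto \<open>u\<close> minus the identity.\<close>

lemma V_Ra_pi_diff:
  assumes A: "transpose A = A" and v: "norm v = 1" "A *v v = c *\<^sub>R v" and u: "norm u = 1"
  shows "V A (Ra pi v) - V A (Ra pi v ** Ra s u)
    = (1 - cos s) * (trace A - u \<bullet> (A *v u) - 2 * c * (1 - (u \<bullet> v)\<^sup>2))"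
proof -
  define P :: mat3 where "P = (columnvector v :: real^1^3) ** rowvector v"
  define M where "M = (2 * c) *\<^sub>R P - A"
  have M: "A ** Ra pi v = M"
    using mult_Ra_pi_unit_eigenvector[OF v] by (simp add: M_def P_def)
  have Mt: "transpose M = M"
    using A by (simp add: M_def P_def symmetric_mat3_iff columnvector_def rowvector_def matrix_matrix_mult_def)
  have hh: "trace (M ** (hat u ** hat u)) = u \<bullet> (M *v u) - (u \<bullet> u) * trace M"
    by (simp add: mat3_simps algebra_simps)
  have uu: "u \<bullet> u = 1" "v \<bullet> v = 1" using u v by (simp_all add: norm_eq_1)
  have P: "u \<bullet> (P *v u) = (u \<bullet> v)\<^sup>2" "trace P = v \<bullet> v"
    by (simp_all add: P_def mat3_simps columnvector_def rowvector_def algebra_simps power2_eq_square)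
  have "V A (Ra pi v) - V A (Ra pi v ** Ra s u) = trace (M ** Ra s u) - trace M"
    by (simp add: V_def mat3_mult.diff_right trace_sub matrix_mul_assoc M)
  also have "\<dots> = (1 - cos s) * trace (M ** (hat u ** hat u))"
    using Mt trace_mult_hat_eq_0_iff[of M]
    by (simp add: Ra_def mat3_mult.add_right mat3_mult.scaleR_right trace_add)
      (simp add: trace_def scaleR_sum_right flip: sum_distrib_left)
  also have "trace (M ** (hat u ** hat u)) = trace A - u \<bullet> (A *v u) - 2 * c * (1 - (u \<bullet> v)\<^sup>2)"
    unfolding hh by (simp add: uu M_def matrix_vector_mult_diff_rdistrib trace_sub inner_diff_right P
       flip: scaleR_matrix_vector_assoc) (use P(2) uu in \<open>simp add: trace_def algebra_simps flip: sum_distrib_left\<close>)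
  finally show ?thesis .
qed

section \<open>Compactness of the rotation group and calculus on it\<close>

lemma compact_SO3: "compact SO3"
proof -
  have "closed {R :: mat3. transpose R ** R = mat 1 \<and> R ** transpose R = mat 1 \<and> det R = 1}"
    unfolding mat3_simps det_3 vec_lambda_beta
    by (intro closed_Collect_conj closed_Collect_eq continuous_intros)
  moreover have "SO3 = {R. transpose R ** R = mat 1 \<and> R ** transpose R = mat 1 \<and> det R = 1}"
    using SO3_iff by blast
  \<comment> \<open>Columns are unit vectors, so entries are at most 1 in absolute value; the crude
    l1 estimate gives 3 for each row and 9 for the matrix.\<close>
  moreover have "norm R \<le> 9" if "R \<in> SO3" for R
  proof -
    have e: "\<bar>R $ i $ j\<bar> \<le> 1" for i j
    proof -
      have "norm (R *v axis j 1) = 1"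
        using SO3_inner[OF that, of "axis j 1" "axis j 1"] by (simp add: norm_eq_1)
      then show ?thesis
        using component_le_norm_cart[of "R *v axis j 1" i]
        by (simp add: matrix_vector_mult_basis column_def)
    qed
    have "norm (R $ i) \<le> 3" for i
      using norm_le_l1_cart[of "R $ i"] e[of i 1] e[of i 2] e[of i 3] by (simp add: sum_3)
    moreover have "norm R \<le> (\<Sum>i\<in>UNIV. norm (R $ i))"
      unfolding norm_vec_def by (rule L2_set_le_sum) simp
    ultimately show ?thesis
      unfolding sum_3 by (smt (verit, best))
  qed
  then have "bounded SO3" by (auto simp: bounded_iff)
  ultimately show ?thesis by (simp add: compact_eq_bounded_closed)
qed

lemma Ra_has_vector_derivative:
  "((\<lambda>t. Ra t u) has_vector_derivative cos t *\<^sub>R hat u + sin t *\<^sub>R (hat u ** hat u)) (at t within S)"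
  unfolding Ra_def by (auto intro!: derivative_eq_intros simp: has_vector_derivative_def algebra_simps)

text \<open>The curve stays in \<open>SO3\<close> and has velocity \<open>R ** hat w\<close> at 0,
  so a derivative within \<open>SO3\<close> restricts to an ordinary derivative in one real
  variable.\<close>

lemma SO3_derivative_along_curve:
  assumes f: "(f has_derivative f') (at R within SO3)" and R: "R \<in> SO3" and w: "norm w = 1"
  shows "((\<lambda>t. f (R ** Ra t w)) has_vector_derivative f' (R ** hat w)) (at 0)"
proof -
  let ?c = "\<lambda>t. R ** Ra t w"
  have "(?c has_vector_derivative R ** hat w) (at 0)"
    using bounded_linear.has_vector_derivative[OF mat3_mult.bounded_linear_right[of R] Ra_has_vector_derivative[of w 0 UNIV]]
    by simp
  moreover have "(f has_derivative f') (at (?c 0) within range ?c)"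
    using f R w by (auto simp: Ra_0 intro: mult_in_SO3 Ra_in_SO3 has_derivative_subset)
  ultimately show ?thesis
    using vector_derivative_diff_chain_within[of ?c _ 0 UNIV f f'] by (simp add: o_def)
qed

lemma linear_hat_tangent:
  fixes R :: mat3
  assumes "linear f'"
  shows "linear (\<lambda>w. f' (R ** hat w))"
  using assms linear_hat
  by (auto intro!: linearI simp: linear_add linear_cmul mat3_mult.add_right mat3_mult.scaleR_right)

text \<open>The curves \<open>R ** Ra t w\<close> only give information for unit axes; homogeneity
  extends it to all \<open>w\<close>.\<close>

lemma linear_eq_if_eq_on_sphere:
  assumes "linear h" "linear k" "\<And>w :: real^3. norm w = 1 \<Longrightarrow> h w = k w"
  shows "h w = k w"
proof (cases "w = 0")
  case True
  then show ?thesis using assms by (simp add: linear_0)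
next
  case False
  then have "h (w /\<^sub>R norm w) = k (w /\<^sub>R norm w)" by (intro assms) simp
  then show ?thesis using False assms(1,2) by (simp add: linear_cmul)
qed

text \<open>\<open>SO3\<close> is not open in the space of matrices, so a derivative within it is
  determined only on tangent vectors, where the curves compute it.\<close>

lemma SO3_derivative_unique:
  assumes "(f has_derivative f') (at R within SO3)" "(f has_derivative f'') (at R within SO3)" "R \<in> SO3"
  shows "f' (R ** hat w) = f'' (R ** hat w)"
proof (rule linear_eq_if_eq_on_sphere)
  fix w :: "real^3" assume "norm w = 1"
  then show "f' (R ** hat w) = f'' (R ** hat w)"
    using assms SO3_derivative_along_curve vector_derivative_unique_at by metis
qed (use assms in \<open>auto intro!: linear_hat_tangent dest: has_derivative_linear\<close>)

lemma SO3_derivative_zero_at_min: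
  fixes f :: "mat3 \<Rightarrow> real"
  assumes f: "(f has_derivative f') (at R within SO3)" and R: "R \<in> SO3"
    and min: "\<And>S. S \<in> SO3 \<Longrightarrow> f R \<le> f S"
  shows "f' (R ** hat w) = 0"
proof (rule linear_eq_if_eq_on_sphere[of _ "\<lambda>_. 0"])
  fix w :: "real^3" assume w: "norm w = 1"
  have "((\<lambda>t. f (R ** Ra t w)) has_real_derivative f' (R ** hat w)) (at 0)"
    using SO3_derivative_along_curve[OF f R w] by (simp add: has_real_derivative_iff_has_vector_derivative)
  then show "f' (R ** hat w) = 0"
  proof (rule DERIV_local_min[where d = 1])
    have "f R \<le> f (R ** Ra t w)" for t
      by (intro min mult_in_SO3 R Ra_in_SO3 w)
    then show "\<forall>t. \<bar>0 - t\<bar> < 1 \<longrightarrow> f (R ** Ra 0 w) \<le> f (R ** Ra t w)"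
      by (simp add: Ra_0)
  qed simp
next
  show "linear (\<lambda>w. f' (R ** hat w))"
    by (rule linear_hat_tangent[OF has_derivative_linear[OF f]])
qed (simp add: linear_iff)

lemma metric_SO3_hat: "R \<in> SO3 \<Longrightarrow> metric_SO3 R (R ** hat v) (R ** hat w) = 2 * (v \<bullet> w)"
  by (simp add: metric_SO3_def matrix_mul_assoc SO3_iff trace_hat_hat)

text \<open>Riesz representation in axis coordinates. The metric is twice the Euclidean inner
  product, hence the halved coefficients of \<open>g\<close>. Uniqueness of the gradient, which the
  definite description requires, follows from that of the derivative on tangent vectors.\<close>

lemma grad_SO3_eq:
  assumes f: "(f has_derivative f') (at R within SO3)" and R: "R \<in> SO3"
  obtains g where "grad_SO3 f R = R ** hat g" "\<And>w. f' (R ** hat w) = 2 * (g \<bullet> w)"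
proof -
  define h where "h w = f' (R ** hat w)" for w
  have lin: "linear h"
    unfolding h_def using f by (auto intro!: linear_hat_tangent dest: has_derivative_linear)
  define g :: "real^3" where "g = (\<chi> i. h (axis i 1) / 2)"
  have h: "h w = 2 * (g \<bullet> w)" for w
  proof -
    have "w = w$1 *\<^sub>R axis 1 1 + w$2 *\<^sub>R axis 2 1 + w$3 *\<^sub>R axis 3 1"
      by (simp add: vec_eq_iff forall_3 axis_def)
    then have "h w = h (w$1 *\<^sub>R axis 1 1 + w$2 *\<^sub>R axis 2 1 + w$3 *\<^sub>R axis 3 1)"
      by (rule arg_cong)
    also have "\<dots> = w$1 * h (axis 1 1) + w$2 * h (axis 2 1) + w$3 * h (axis 3 1)"
      by (simp add: linear_add[OF lin] linear_cmul[OF lin])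
    finally show ?thesis by (simp add: g_def inner_vec_def sum_3)
  qed
  have "has_gradient_SO3 f R (R ** hat g)"
    unfolding has_gradient_SO3_def tangent_SO3_eq
    using f h R by (auto simp: metric_SO3_hat h_def intro!: exI[of _ f'])
  moreover have "G = R ** hat g" if G: "has_gradient_SO3 f R G" for G
  proof -
    obtain k f'' where k: "G = R ** hat k" "(f has_derivative f'') (at R within SO3)"
      and "\<forall>w. f'' (R ** hat w) = metric_SO3 R G (R ** hat w)"
      using G unfolding has_gradient_SO3_def tangent_SO3_eq by blast
    then have "f'' (R ** hat w) = 2 * (k \<bullet> w)" for w
      using R by (simp add: metric_SO3_hat)
    then have "k \<bullet> w = g \<bullet> w" for w
      using SO3_derivative_unique[OF f k(2) R, of w] h[of w] by (simp add: h_def)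
    then have "k = g" using vector_eq_rdot by blast
    then show ?thesis by (simp add: k)
  qed
  ultimately have "grad_SO3 f R = R ** hat g"
    unfolding grad_SO3_def by (rule the_equality)
  then show thesis using h that by (simp add: h_def)
qed

lemma grad_SO3_eq_0_iff:
  assumes f: "(f has_derivative f') (at R within SO3)" and R: "R \<in> SO3"
  shows "grad_SO3 f R = 0 \<longleftrightarrow> (\<forall>w. f' (R ** hat w) = 0)"
proof -
  obtain g where g: "grad_SO3 f R = R ** hat g" "\<And>w. f' (R ** hat w) = 2 * (g \<bullet> w)"
    using grad_SO3_eq[OF f R] by metis
  have "hat g = transpose R ** (R ** hat g)"
    using R by (simp add: matrix_mul_assoc SO3_iff)
  then have "grad_SO3 f R = 0 \<longleftrightarrow> g = 0"
    unfolding g by (metis hat_eq_0_iff mat3_mult.zero_right)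
  also have "\<dots> \<longleftrightarrow> (\<forall>w. f' (R ** hat w) = 0)"
    unfolding g by (metis all_zero_iff inner_commute mult_eq_0_iff zero_neq_numeral)
  finally show ?thesis .
qed

text \<open>This expresses the differential through the vector that occurs in \<open>Theta\<close>;
  the factor 2 of the metric is the factor 2 there.\<close>

lemma psi_grad_SO3:
  assumes f: "(f has_derivative f') (at R within SO3)" and R: "R \<in> SO3"
  shows "f' (R ** hat w) = 2 * (psi (transpose R ** grad_SO3 f R) \<bullet> w)"
proof -
  obtain g where g: "grad_SO3 f R = R ** hat g" "\<And>w. f' (R ** hat w) = 2 * (g \<bullet> w)"
    using grad_SO3_eq[OF f R] by metis
  then show ?thesis
    using R by (simp add: matrix_mul_assoc SO3_iff psi_hat)
qed

section \<open>Maps of the rotation group with surjective differential\<close>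

text \<open>\<open>L\<close> is the differential of \<open>F\<close> at \<open>R\<close> when both tangent spaces are left-translated to \<open>so3\<close>.\<close>

definition SO3_submersive :: "(mat3 \<Rightarrow> mat3) \<Rightarrow> bool" where
  "SO3_submersive F \<longleftrightarrow> F ` SO3 \<subseteq> SO3 \<and>
     (\<forall>R\<in>SO3. \<exists>F' L. (F has_derivative F') (at R within SO3) \<and> surj L \<and>
        (\<forall>w. F' (R ** hat w) = F R ** hat (L w)))"

lemma SO3_submersive_id: "SO3_submersive (\<lambda>R. R)"
  unfolding SO3_submersive_def
  by (intro conjI ballI exI[of _ "\<lambda>x. x"]) (auto intro: surjI)

lemma SO3_submersive_in: "SO3_submersive F \<Longrightarrow> R \<in> SO3 \<Longrightarrow> F R \<in> SO3"
  by (auto simp: SO3_submersive_def)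

lemma SO3_submersive_continuous_on: "SO3_submersive F \<Longrightarrow> continuous_on SO3 F"
  unfolding SO3_submersive_def continuous_on_eq_continuous_within
  by (meson has_derivative_continuous)

lemma bounded_linear_trace_mult: "bounded_linear (\<lambda>X. trace (B ** X))" for B :: mat3
  unfolding linear_conv_bounded_linear [symmetric]
  by (rule linearI) (simp_all add: mat3_mult.add_right mat3_mult.scaleR_right trace_def sum.distrib sum_distrib_left)

text \<open>The derivative in direction \<open>R ** hat w\<close> is the trace of
  \<open>(B ** F R) ** hat (L w)\<close>. As \<open>L\<close> is onto, vanishing for all
  \<open>w\<close> means vanishing against every skew matrix. It is applied both with
  \<open>B = A\<close> and with the transpose of a target rotation \<open>P\<close>.\<close>

lemma SO3_submersive_trace_derivative:
  assumes F: "SO3_submersive F" and R: "R \<in> SO3"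
  obtains f' where "((\<lambda>R. trace (B ** F R)) has_derivative f') (at R within SO3)"
    "(\<forall>w. f' (R ** hat w) = 0) \<longleftrightarrow> transpose (B ** F R) = B ** F R"
proof -
  obtain F' L where F': "(F has_derivative F') (at R within SO3)" and L: "surj L"
    "\<And>w. F' (R ** hat w) = F R ** hat (L w)"
    using F R unfolding SO3_submersive_def by blast
  have "(\<forall>w. trace (B ** F' (R ** hat w)) = 0) \<longleftrightarrow> (\<forall>w. trace ((B ** F R) ** hat w) = 0)"
    using L by (metis (no_types) surj_def matrix_mul_assoc)
  then have "(\<forall>w. trace (B ** F' (R ** hat w)) = 0) \<longleftrightarrow> transpose (B ** F R) = B ** F R"
    by (simp add: trace_mult_hat_eq_0_iff)
  with bounded_linear.has_derivative[OF bounded_linear_trace_mult F'] show thesis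
    by (rule that)
qed

lemma SO3_submersive_trace_extremum:
  assumes F: "SO3_submersive F" and R: "R \<in> SO3"
    and ext: "(\<forall>S\<in>SO3. trace (B ** F R) \<le> trace (B ** F S)) \<or> (\<forall>S\<in>SO3. trace (B ** F S) \<le> trace (B ** F R))"
  shows "transpose (B ** F R) = B ** F R"
proof -
  obtain f' where f': "((\<lambda>R. trace (B ** F R)) has_derivative f') (at R within SO3)"
    and iff: "(\<forall>w. f' (R ** hat w) = 0) \<longleftrightarrow> transpose (B ** F R) = B ** F R"
    by (rule SO3_submersive_trace_derivative[OF F R])
  have "f' (R ** hat w) = 0" for w
    using ext
  proof
    assume "\<forall>S\<in>SO3. trace (B ** F R) \<le> trace (B ** F S)"
    then show ?thesis using SO3_derivative_zero_at_min[OF f' R] by blast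
  next
    assume "\<forall>S\<in>SO3. trace (B ** F S) \<le> trace (B ** F R)"
    then show ?thesis using SO3_derivative_zero_at_min[OF has_derivative_minus[OF f'] R, of w] by simp
  qed
  then show ?thesis using iff by blast
qed

text \<open>A missed \<open>P\<close> makes every critical value of \<open>trace (P\<^sup>T F R)\<close> equal to \<open>- 1\<close>, so this function is
  constant and \<open>P\<^sup>T F R\<close> is symmetric for all \<open>R\<close>, which an open set of rotations cannot be.\<close>

lemma SO3_submersive_surj:
  assumes F: "SO3_submersive F" and P: "P \<in> SO3"
  shows "\<exists>R\<in>SO3. F R = P"
proof (rule ccontr)
  assume no: "\<not> (\<exists>R\<in>SO3. F R = P)"
  let ?f = "\<lambda>R. trace (transpose P ** F R)"
  let ?G = "\<lambda>R. transpose P ** F R"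
  have G: "?G R \<in> SO3" if "R \<in> SO3" for R
    using mult_in_SO3[OF transpose_in_SO3[OF P] SO3_submersive_in[OF F that]] .
  have crit: "?f R = - 1" if R: "R \<in> SO3" and symm: "transpose (?G R) = ?G R" for R
  proof -
    have "?G R \<noteq> mat 1"
    proof
      assume "?G R = mat 1"
      then have "P ** ?G R = P" by simp
      then have "F R = P" using P by (simp add: matrix_mul_assoc SO3_iff)
      then show False using no R by blast
    qed
    then obtain v where "norm v = 1" "?G R = Ra pi v"
      using symmetric_SO3_cases[OF G[OF R] symm] by blast
    then show ?thesis by (simp add: trace_Ra norm_eq_1)
  qed
  have cont: "continuous_on SO3 ?f"
    using SO3_submersive_continuous_on[OF F]
    by (rule bounded_linear.continuous_on[OF bounded_linear_trace_mult])
  have ne: "SO3 \<noteq> {}" using mat_1_in_SO3 by blast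
  obtain Rmin where min: "Rmin \<in> SO3" "\<forall>S\<in>SO3. ?f Rmin \<le> ?f S"
    using continuous_attains_inf[OF compact_SO3 ne cont] by blast
  obtain Rmax where max: "Rmax \<in> SO3" "\<forall>S\<in>SO3. ?f S \<le> ?f Rmax"
    using continuous_attains_sup[OF compact_SO3 ne cont] by blast
  have "?f Rmin = - 1" "?f Rmax = - 1"
    using min max by (auto intro!: crit SO3_submersive_trace_extremum[OF F])
  then have const: "?f R = - 1" if "R \<in> SO3" for R
    using min(2) max(2) that by (metis order_antisym)
  have sym: "transpose (?G R) = ?G R" if "R \<in> SO3" for R
    using that const by (auto intro!: SO3_submersive_trace_extremum[OF F])
  define S where "S = ?G (mat 1)"
  have S: "S \<in> SO3" "transpose S = S" using G sym mat_1_in_SO3 by (auto simp: S_def)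
  obtain F' L where F': "(F has_derivative F') (at (mat 1) within SO3)" and L: "surj L"
    "\<And>w. F' (mat 1 ** hat w) = F (mat 1) ** hat (L w)"
    using F mat_1_in_SO3 unfolding SO3_submersive_def by blast
  have dG: "(?G has_derivative (\<lambda>X. transpose P ** F' X)) (at (mat 1) within SO3)"
    using bounded_linear.has_derivative[OF mat3_mult.bounded_linear_right F'] .
  have bl: "bounded_linear (transpose :: mat3 \<Rightarrow> mat3)"
    unfolding linear_conv_bounded_linear [symmetric] by (rule linearI) (simp_all add: transpose_def vec_eq_iff)
  \<comment> \<open>On \<open>SO3\<close> the map \<open>?G\<close> equals its own transpose, so
    transposing its derivative gives another derivative of the same map; the two agree on tangent
    vectors.\<close>
  have "(?G has_derivative (\<lambda>X. transpose (transpose P ** F' X))) (at (mat 1) within SO3)"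
    by (rule has_derivative_transform[OF mat_1_in_SO3 _ bounded_linear.has_derivative[OF bl dG]])
      (simp add: sym)
  from SO3_derivative_unique[OF dG this mat_1_in_SO3]
  have "S ** hat (L w) = transpose (S ** hat (L w))" for w
    by (simp only: L S_def matrix_mul_assoc)
  then have "S ** hat x = transpose (S ** hat x)" for x
    using L(1) by (metis surjD)
  \<comment> \<open>\<open>S\<close> anticommutes with every skew matrix, so the matrix W formed
    from \<open>S\<close> is zero. With trace -1 this makes \<open>S\<close> equal to
    \<open>- mat 1\<close>, which is no rotation in dimension three.\<close>
  then have "S ** hat x + hat x ** S = 0" for x
    by (simp add: matrix_transpose_mul S transpose_hat mat3_mult.minus_left add_eq_0_iff2)
  then have "(trace S *\<^sub>R mat 1 - S) *v x = 0" for x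
    by (simp add: anticommutator_hat[OF S(2)] hat_eq_0_iff)
  then have "trace S *\<^sub>R mat 1 - S = 0" by (simp add: matrix_eq)
  moreover have "trace S = - 1" using const mat_1_in_SO3 by (simp add: S_def)
  ultimately have "S = - mat 1" by simp
  then have "det S = - 1" by (simp add: det_3 mat_def)
  then show False using S by (simp add: SO3_iff)
qed

section \<open>Positivity of the potential, and the differential of \<open>Gamma_map\<close>\<close>

lemma V_eq: "V A R = trace A - trace (A ** R)"
  by (simp add: V_def mat3_mult.diff_right trace_sub)

text \<open>Writing the value as a quadratic form of W makes it positive as soon as W is positive
  definite.\<close>

lemma V_Ra_pi:
  assumes v: "norm v = 1" and Av: "A *v v = c *\<^sub>R v"
  shows "V A (Ra pi v) = 2 * (v \<bullet> ((trace A *\<^sub>R mat 1 - A) *v v))"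
proof -
  have "trace ((columnvector v :: real^1^3) ** rowvector v) = v \<bullet> v"
    by (simp add: mat3_simps columnvector_def rowvector_def)
  then have "trace ((2 * c) *\<^sub>R ((columnvector v :: real^1^3) ** rowvector v)) = 2 * c"
    using v by (simp add: trace_def norm_eq_1 flip: sum_distrib_left)
  then show ?thesis
    using v by (simp add: V_eq mult_Ra_pi_unit_eigenvector[OF assms] trace_sub matrix_vector_mult_diff_rdistrib
      Av norm_eq_1 inner_diff_right flip: scaleR_matrix_vector_assoc)
qed

text \<open>A minimiser of \<open>V A\<close> is critical for the identity map, and at the critical half turns \<open>V A\<close> is
  positive while \<open>V A (mat 1) = 0\<close>.\<close>

lemma V_pos:
  assumes A: "transpose A = A" and W: "symmetric_positive_definite (trace A *\<^sub>R mat 1 - A)"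
    and G: "G \<in> SO3" "G \<noteq> mat 1"
  shows "0 < V A G"
proof -
  have min: "S = mat 1" if S: "S \<in> SO3" and max: "\<forall>R\<in>SO3. trace (A ** R) \<le> trace (A ** S)" for S
  proof (rule ccontr)
    assume "S \<noteq> mat 1"
    moreover have "transpose (A ** S) = A ** S"
      using SO3_submersive_trace_extremum[OF SO3_submersive_id] S max by blast
    ultimately obtain v c where v: "norm v = 1" "A *v v = c *\<^sub>R v" "S = Ra pi v"
      using symmetric_mult_SO3_iff[OF A W S] by (auto simp: unit_eigenvectors_def)
    moreover have "v \<noteq> 0" using v by auto
    ultimately have "V A S > 0"
      using W by (simp add: V_Ra_pi symmetric_positive_definite_def)
    moreover have "V A S \<le> 0"
      using max mat_1_in_SO3 by (force simp: V_eq)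
    ultimately show False by simp
  qed
  have "continuous_on SO3 (\<lambda>R. trace (A ** R))"
    by (rule linear_continuous_on[OF bounded_linear_trace_mult])
  then obtain S where S: "S \<in> SO3" "\<forall>R\<in>SO3. trace (A ** R) \<le> trace (A ** S)"
    using continuous_attains_sup[OF compact_SO3] mat_1_in_SO3 by blast
  then have le: "trace (A ** R) \<le> trace A" if "R \<in> SO3" for R
    using min[OF S] that by simp
  \<comment> \<open>Equality would make \<open>G\<close> a maximiser too, and then
    \<open>min\<close> would identify it with the identity.\<close>
  have "trace (A ** G) \<noteq> trace A"
    using min[OF G(1)] G(2) le by auto
  then show ?thesis using le[OF G(1)] by (simp add: V_eq)
qed

text \<open>The right-hand side is the derivative of \<open>Ra t u\<close> in \<open>t\<close>, so
  the velocity of this one-parameter group is a left translate of \<open>hat u\<close>.\<close>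

lemma Ra_mult_hat:
  assumes "norm u = 1"
  shows "Ra t u ** hat u = cos t *\<^sub>R hat u + sin t *\<^sub>R (hat u ** hat u)"
proof -
  have "(hat u ** hat u) ** hat u = - hat u"
    using assms hat_cubed[of u] by (simp add: norm_eq_1 flip: matrix_mul_assoc)
  then show ?thesis
    by (simp add: Ra_def mat3_mult.add_left mat3_mult.scaleR_left) (simp add: algebra_simps)
qed

text \<open>By the product rule the differential has two terms: varying the angle contributes a
  multiple of \<open>P ** hat u\<close>, and varying \<open>R\<close> contributes
  \<open>hat w ** P\<close>, which is \<open>P ** hat (transpose P *v w)\<close>. Together they are
  \<open>P ** hat\<close> of \<open>Theta\<close> applied to \<open>w\<close>, so \<open>L\<close>
  is multiplication by \<open>Theta\<close>, and its nonzero determinant makes it onto.\<close>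

lemma SO3_submersive_Gamma_map:
  assumes u: "norm u = 1" and diff: "\<theta> q differentiable_on SO3"
    and det: "\<And>R. R \<in> SO3 \<Longrightarrow> det (Theta \<theta> u (R, q)) \<noteq> 0"
  shows "SO3_submersive (\<lambda>R. Gamma_map \<theta> u (R, q))"
  unfolding SO3_submersive_def
proof (intro conjI ballI)
  show "(\<lambda>R. Gamma_map \<theta> u (R, q)) ` SO3 \<subseteq> SO3"
    using u by (auto simp: Gamma_map_def intro: mult_in_SO3 Ra_in_SO3)
next
  fix R assume R: "R \<in> SO3"
  obtain t' where t': "(\<theta> q has_derivative t') (at R within SO3)"
    using diff R by (auto simp: differentiable_on_def differentiable_def)
  define P where "P = Ra (\<theta> q R) u"
  define g where "g = psi (transpose R ** grad_SO3 (\<theta> q) R)"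
  have P: "P \<in> SO3" using u by (simp add: P_def Ra_in_SO3)
  have t'_hat: "t' (R ** hat w) = 2 * (g \<bullet> w)" for w
    using psi_grad_SO3[OF t' R] by (simp add: g_def)
  have "((\<lambda>R. Ra (\<theta> q R) u) has_derivative (\<lambda>X. t' X *\<^sub>R (P ** hat u))) (at R within SO3)"
    using has_derivative_compose[OF t' Ra_has_vector_derivative[unfolded has_vector_derivative_def, of u "\<theta> q R" UNIV]]
    by (simp add: P_def Ra_mult_hat[OF u])
  from mat3_mult.FDERIV[OF has_derivative_ident this]
  have "((\<lambda>R. Gamma_map \<theta> u (R, q)) has_derivative (\<lambda>X. R ** (t' X *\<^sub>R (P ** hat u)) + X ** P)) (at R within SO3)"
    by (simp add: Gamma_map_def P_def)
  moreover have "R ** (t' (R ** hat w) *\<^sub>R (P ** hat u)) + (R ** hat w) ** P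
      = Gamma_map \<theta> u (R, q) ** hat (Theta \<theta> u (R, q) *v w)" for w
  proof -
    have "((columnvector u :: real^1^3) ** rowvector g) *v w = (g \<bullet> w) *\<^sub>R u"
      by (simp add: mat3_simps columnvector_def rowvector_def algebra_simps)
    then have "Theta \<theta> u (R, q) *v w = transpose P *v w + (2 * (g \<bullet> w)) *\<^sub>R u"
      by (simp add: Theta_def P_def g_def matrix_vector_mult_add_rdistrib flip: scaleR_matrix_vector_assoc)
    then have "P ** hat (Theta \<theta> u (R, q) *v w) = hat w ** P + (2 * (g \<bullet> w)) *\<^sub>R (P ** hat u)"
      by (simp add: linear_add[OF linear_hat] linear_cmul[OF linear_hat] mat3_mult.add_right
          mat3_mult.scaleR_right hat_mult_SO3[OF P])
    then show ?thesis
      by (simp add: Gamma_map_def t'_hat mat3_mult.add_right flip: matrix_mul_assoc P_def)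
  qed
  moreover have "surj ((*v) (Theta \<theta> u (R, q)))"
    using det[OF R] invertible_det_nz invertible_right_inverse matrix_right_invertible_surjective
    by blast
  ultimately show "\<exists>F' L. ((\<lambda>R. Gamma_map \<theta> u (R, q)) has_derivative F') (at R within SO3) \<and> surj L \<and>
      (\<forall>w. F' (R ** hat w) = Gamma_map \<theta> u (R, q) ** hat (L w))"
    by blast
qed

section \<open>A uniform formula for \<open>Delta\<close>\<close>

lemma cos_angle: "cos (angle x y) = x \<bullet> y / (norm x * norm y)"
proof -
  \<comment> \<open>For a zero vector the quotient is 0 by the convention on division, so no case
    needs to be excluded.\<close>
  have "\<bar>x \<bullet> y / (norm x * norm y)\<bar> \<le> 1"
    using Cauchy_Schwarz_ineq2[of x y] by (auto simp: divide_le_eq_1 abs_mult zero_less_mult_iff)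
  then show ?thesis by (simp add: angle_def cos_arccos_abs)
qed

lemma orthonormal_expansion:
  fixes b :: "3 \<Rightarrow> real^3"
  assumes "\<forall>i j. b i \<bullet> b j = (if i = j then 1 else 0)"
  shows "x = (\<Sum>i\<in>UNIV. (x \<bullet> b i) *\<^sub>R b i)"
    and "trace A = (\<Sum>i\<in>UNIV. b i \<bullet> (A *v b i))"
proof -
  define B :: mat3 where "B = (\<chi> i. b i)"
  have "B ** transpose B = mat 1"
    using assms by (simp add: B_def matrix_matrix_mult_def transpose_def mat_def vec_eq_iff inner_vec_def)
  \<comment> \<open>Orthonormal rows give orthonormal columns, because a one-sided inverse of a
    square matrix is two-sided.\<close>
  then have B: "transpose B ** B = mat 1"
    by (simp add: matrix_left_right_inverse)
  have "x = transpose B *v (B *v x)"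
    by (simp only: matrix_vector_mul_assoc B matrix_vector_mul_lid)
  also have "\<dots> = (\<Sum>i\<in>UNIV. (x \<bullet> b i) *\<^sub>R b i)"
    by (simp add: mat3_simps B_def algebra_simps)
  finally show "x = (\<Sum>i\<in>UNIV. (x \<bullet> b i) *\<^sub>R b i)" .
  have "trace A = trace (A ** (transpose B ** B))" by (simp add: B)
  also have "\<dots> = trace (B ** (A ** transpose B))"
    using trace_mul_sym[of "A ** transpose B" B] by (simp add: matrix_mul_assoc)
  also have "\<dots> = (\<Sum>i\<in>UNIV. b i \<bullet> (A *v b i))"
    by (simp add: mat3_simps B_def algebra_simps)
  finally show "trace A = (\<Sum>i\<in>UNIV. b i \<bullet> (A *v b i))" .
qed

text \<open>The right-hand side is the coefficient of \<open>1 - cos s\<close> in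
  \<open>V_Ra_pi_diff\<close>, with no distinction by multiplicity of eigenvalues. In coordinates
  with respect to \<open>b\<close>, each case becomes a polynomial identity modulo the normalisation
  of \<open>u\<close>.\<close>

lemma Delta_eq:
  assumes lb: "labelled_eigenbasis A l b" and u: "norm u = 1"
    and v: "norm v = 1" "A *v v = c *\<^sub>R v"
  shows "Delta A l b v u = trace A - u \<bullet> (A *v u) - 2 * c * (1 - (u \<bullet> v)\<^sup>2)"
proof -
  have on: "\<forall>i j. b i \<bullet> b j = (if i = j then 1 else 0)" and Ab: "\<And>i. A *v b i = l i *\<^sub>R b i"
    and cases: "(l 1 = l 2 \<and> l 2 = l 3) \<or> (l 1 = l 2 \<and> l 2 \<noteq> l 3) \<or> (l 1 < l 2 \<and> l 2 < l 3)"
    using lb unfolding labelled_eigenbasis_def by auto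
  have ex: "x = (x \<bullet> b 1) *\<^sub>R b 1 + (x \<bullet> b 2) *\<^sub>R b 2 + (x \<bullet> b 3) *\<^sub>R b 3" for x
    using orthonormal_expansion(1)[OF on, of x] by (simp add: sum_3)
  have inner_ex: "x \<bullet> y = (x \<bullet> b 1) * (y \<bullet> b 1) + (x \<bullet> b 2) * (y \<bullet> b 2) + (x \<bullet> b 3) * (y \<bullet> b 3)" for x y
    using arg_cong[OF ex[of y], of "\<lambda>z. x \<bullet> z"] by (simp add: inner_add_right)
  have A_ex: "A *v x = (x \<bullet> b 1 * l 1) *\<^sub>R b 1 + (x \<bullet> b 2 * l 2) *\<^sub>R b 2 + (x \<bullet> b 3 * l 3) *\<^sub>R b 3" for x
    using arg_cong[OF ex[of x], of "\<lambda>z. A *v z"]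
    by (simp add: matrix_vector_right_distrib matrix_vector_mult_scaleR Ab)
  have tr: "trace A = l 1 + l 2 + l 3"
    using orthonormal_expansion(2)[OF on, of A] on by (simp add: sum_3 Ab)
  have uu: "(u \<bullet> b 1)\<^sup>2 + (u \<bullet> b 2)\<^sup>2 + (u \<bullet> b 3)\<^sup>2 = 1"
    and vv: "(v \<bullet> b 1)\<^sup>2 + (v \<bullet> b 2)\<^sup>2 + (v \<bullet> b 3)\<^sup>2 = 1"
    using u v inner_ex[of u u] inner_ex[of v v] by (simp_all add: norm_eq_1 power2_eq_square)
  have uAu: "u \<bullet> (A *v u) = l 1 * (u \<bullet> b 1)\<^sup>2 + l 2 * (u \<bullet> b 2)\<^sup>2 + l 3 * (u \<bullet> b 3)\<^sup>2"
    by (simp add: A_ex inner_add_right power2_eq_square algebra_simps)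
  \<comment> \<open>Pairing the eigenvector equation with \<open>b i\<close> shows that
    \<open>v\<close> has no component along a \<open>b i\<close> with another eigenvalue.\<close>
  have coef: "(c - l i) * (v \<bullet> b i) = 0" for i
  proof -
    have "c * (v \<bullet> b i) = (A *v v) \<bullet> b i" by (simp add: v)
    also have "\<dots> = l i * (v \<bullet> b i)"
      using exhaust_3[of i] on by (auto simp: A_ex inner_add_left)
    finally show ?thesis by (simp add: algebra_simps)
  qed
  have single: "v = b i \<or> v = - b i" if "\<And>j. j \<noteq> i \<Longrightarrow> v \<bullet> b j = 0" for i
  proof -
    have vi: "v = (v \<bullet> b i) *\<^sub>R b i" "(v \<bullet> b i)\<^sup>2 = 1"
      using ex[of v] vv exhaust_3[of i] that by auto
    then have "v \<bullet> b i = 1 \<or> v \<bullet> b i = - 1" by (simp add: power2_eq_1_iff)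
    then show ?thesis using vi(1) by auto
  qed
  consider (one) "l 1 = l 2" "l 2 = l 3" | (two) "l 1 = l 2" "l 2 \<noteq> l 3" | (three) "l 1 < l 2" "l 2 < l 3"
    using cases by blast
  then show ?thesis
  proof cases
    case one
    have "c = l 3"
      using coef[of 1] coef[of 2] coef[of 3] vv one by auto
    moreover have "l 3 * (u \<bullet> b 1)\<^sup>2 + l 3 * (u \<bullet> b 2)\<^sup>2 + l 3 * (u \<bullet> b 3)\<^sup>2 = l 3"
      using uu by (simp flip: distrib_left)
    ultimately show ?thesis
      using one u v(1) by (simp add: Delta_def cos_angle tr uAu algebra_simps)
  next
    case two
    define w where "w = (u \<bullet> b 1) *\<^sub>R b 1 + (u \<bullet> b 2) *\<^sub>R b 2"
    have uu': "(u \<bullet> b 2)\<^sup>2 = 1 - (u \<bullet> b 1)\<^sup>2 - (u \<bullet> b 3)\<^sup>2" using uu by simp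
    show ?thesis
    proof (cases "v \<in> span {b 1, b 2}")
      case True
      then have v3: "v \<bullet> b 3 = 0"
        using on by (auto simp: span_insert span_singleton inner_diff_left algebra_simps)
      then have c: "c = l 2"
        using coef[of 1] coef[of 2] vv two by auto
      have wv: "v \<bullet> w = u \<bullet> v"
        using v3 inner_ex[of u v] by (simp add: w_def inner_add_right)
      have ww: "(norm w)\<^sup>2 = 1 - (u \<bullet> b 3)\<^sup>2"
        using on uu unfolding power2_norm_eq_inner
        by (simp add: w_def inner_add_right inner_add_left power2_eq_square)
      \<comment> \<open>This also holds for \<open>w = 0\<close>, where both sides vanish whatever
        the angle is.\<close>
      have "(norm w)\<^sup>2 * (cos (angle v w))\<^sup>2 = (u \<bullet> v)\<^sup>2"
        using v(1) by (cases "w = 0") (auto simp: cos_angle power_divide simp flip: wv)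
      then have "(1 - (u \<bullet> b 3)\<^sup>2) * (sin (angle v w))\<^sup>2 = 1 - (u \<bullet> b 3)\<^sup>2 - (u \<bullet> v)\<^sup>2"
        by (simp add: sin_squared_eq ww right_diff_distrib)
      moreover have "Delta A l b v u = (1 - (u \<bullet> b 3)\<^sup>2) * (trace A - l 2)
          - (trace A - l 3) * ((1 - (u \<bullet> b 3)\<^sup>2) * (sin (angle v w))\<^sup>2)"
      proof -
        have "Delta A l b v u = (1 - (u \<bullet> b 3)\<^sup>2) * (trace A - l 2 - (trace A - l 3) * (sin (angle v w))\<^sup>2)"
          unfolding Delta_def Let_def w_def [symmetric] using two True by (simp only: if_True if_False simp_thms)
        then show ?thesis by (simp only: right_diff_distrib mult.left_commute mult.commute)
      qed
      ultimately have "Delta A l b v u = (1 - (u \<bullet> b 3)\<^sup>2) * (trace A - l 2)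
          - (trace A - l 3) * (1 - (u \<bullet> b 3)\<^sup>2 - (u \<bullet> v)\<^sup>2)"
        by simp
      then show ?thesis
        using two by (simp add: tr uAu c uu' algebra_simps)
    next
      case False
      have "v \<bullet> b 3 \<noteq> 0"
      proof
        assume "v \<bullet> b 3 = 0"
        then have "v = (v \<bullet> b 1) *\<^sub>R b 1 + (v \<bullet> b 2) *\<^sub>R b 2" using ex[of v] by simp
        then show False using False by (metis insertCI span_add span_base span_scale)
      qed
      then have c: "c = l 3" using coef[of 3] by simp
      have "v = b 3 \<or> v = - b 3"
        using coef two c by (intro single) (metis exhaust_3 mult_eq_0_iff right_minus_eq)
      then have "(u \<bullet> v)\<^sup>2 = (u \<bullet> b 3)\<^sup>2" by auto
      then show ?thesis
        using two False by (simp add: Delta_def tr uAu c uu' algebra_simps)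
    qed
  next
    case three
    obtain i where i: "v \<bullet> b i \<noteq> 0"
      using vv by (metis add.right_neutral power_zero_numeral zero_neq_one)
    then have c: "c = l i" using coef[of i] by simp
    have vi: "v = b i \<or> v = - b i"
      using coef three c exhaust_3[of i] by (intro single) (smt (verit, best) exhaust_3 mult_eq_0_iff)
    then have uv: "(u \<bullet> v)\<^sup>2 = (u \<bullet> b i)\<^sup>2" by auto
    \<comment> \<open>These inequalities select the right branch of the nested conditionals in
      \<open>Delta\<close>.\<close>
    have ne: "v \<noteq> b j" "v \<noteq> - b j" if "j \<noteq> i" for j
      using i on that by auto
    have uu': "(u \<bullet> b 3)\<^sup>2 = 1 - (u \<bullet> b 1)\<^sup>2 - (u \<bullet> b 2)\<^sup>2" using uu by simp
    consider "i = 1" | "i = 2" | "i = 3" using exhaust_3 by blast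
    then show ?thesis
      by cases (use three vi ne[of 1] ne[of 2] in \<open>auto simp: Delta_def tr uAu c uv uu' algebra_simps\<close>)
  qed
qed

section \<open>Topological preparations and the equivalence\<close>

lemma continuous_on_Min:
  fixes f :: "'i \<Rightarrow> 'a::topological_space \<Rightarrow> 'b::linorder_topology"
  assumes "finite I" "I \<noteq> {}" "\<And>i. i \<in> I \<Longrightarrow> continuous_on S (f i)"
  shows "continuous_on S (\<lambda>x. Min ((\<lambda>i. f i x) ` I))"
  using assms
proof (induction I rule: finite_ne_induct)
  case (insert i I)
  then have "continuous_on S (\<lambda>x. min (f i x) (Min ((\<lambda>i. f i x) ` I)))"
    by (intro continuous_on_min) auto
  then show ?case using insert by simp
qed simp

text \<open>The eigenvalue of a unit eigenvector must be its Rayleigh quotient. Substituting it for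
  the existential \<open>c\<close> leaves a closed condition on the sphere.\<close>

lemma compact_unit_eigenvectors: "compact (unit_eigenvectors A)"
proof -
  have "unit_eigenvectors A = sphere 0 1 \<inter> {v. A *v v = (v \<bullet> (A *v v)) *\<^sub>R v}"
    by (auto simp: unit_eigenvectors_def norm_eq_1 dist_norm)
  moreover have "continuous_on UNIV ((*v) A)"
    by (simp add: linear_continuous_on linear_linear)
  then have "closed {v. A *v v = (v \<bullet> (A *v v)) *\<^sub>R v}"
    by (intro closed_Collect_eq continuous_intros)
  ultimately show ?thesis by (simp add: compact_Int_closed)
qed

lemma continuous_on_Ra_axis: "continuous_on S (Ra t)"
proof -
  have "continuous_on S hat"
    using linear_hat by (simp add: linear_continuous_on linear_linear)
  then show ?thesis
    unfolding Ra_def by (intro continuous_intros mat3_mult.continuous_on)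
qed

lemma Gamma_map_index_change:
  assumes "norm u = 1"
  shows "Gamma_map \<theta> u (R, p) = Gamma_map \<theta> u (R, q) ** Ra (\<theta> p R - \<theta> q R) u"
  by (simp add: Gamma_map_def Ra_mult[OF assms] flip: matrix_mul_assoc)

lemma V_SO3_submersive_derivative:
  assumes F: "SO3_submersive F" and R: "R \<in> SO3"
  shows "(\<lambda>R. V A (F R)) differentiable (at R within SO3)"
    and "grad_SO3 (\<lambda>R. V A (F R)) R = 0 \<longleftrightarrow> transpose (A ** F R) = A ** F R"
proof -
  obtain f' where f': "((\<lambda>R. trace (A ** F R)) has_derivative f') (at R within SO3)"
    and iff: "(\<forall>w. f' (R ** hat w) = 0) \<longleftrightarrow> transpose (A ** F R) = A ** F R"
    by (rule SO3_submersive_trace_derivative[OF F R])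
  have "((\<lambda>R. V A (F R)) has_derivative (\<lambda>X. - f' X)) (at R within SO3)"
    unfolding V_eq using has_derivative_diff[OF has_derivative_const f'] by simp
  then show "(\<lambda>R. V A (F R)) differentiable (at R within SO3)"
    and "grad_SO3 (\<lambda>R. V A (F R)) R = 0 \<longleftrightarrow> transpose (A ** F R) = A ** F R"
    using iff R by (auto simp: differentiable_def grad_SO3_eq_0_iff)
qed

theorem theorem1:
  fixes A :: "real^3^3" and Q :: "nat set" and u :: "real^3"
    and \<theta> :: "nat \<Rightarrow> real^3^3 \<Rightarrow> real"
    and l :: "3 \<Rightarrow> real" and b :: "3 \<Rightarrow> real^3"
  assumes sym: "transpose A = A"
    and W_pd: "symmetric_positive_definite (trace A *\<^sub>R mat 1 - A)"
    and eigenbasis: "labelled_eigenbasis A l b"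
    and Q: "finite Q" "card Q \<ge> 2"
    and u: "norm u = 1"
    and theta_diff: "\<forall>q\<in>Q. \<theta> q differentiable_on SO3"
    and theta_inj: "\<forall>R\<in>SO3. \<forall>p\<in>Q. \<forall>q\<in>Q. p \<noteq> q \<longrightarrow> \<theta> p R - \<theta> q R \<noteq> 0"
    and theta_inj_angle: "\<forall>R\<in>SO3 - {mat 1}. \<forall>p\<in>Q. \<forall>q\<in>Q. p \<noteq> q \<longrightarrow>
           (\<forall>k::int. \<theta> p R - \<theta> q R \<noteq> 2 * pi * of_int k)"
    and Theta_det: "\<forall>x\<in>SO3 \<times> Q. det (Theta \<theta> u x) \<noteq> 0"
    and Gamma_preimage: "{x \<in> SO3 \<times> Q. Gamma_map \<theta> u x \<in> {mat 1}} = {mat 1} \<times> Q"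
  shows "synergistic Q (\<lambda>x. V A (Gamma_map \<theta> u x)) \<longleftrightarrow>
           (\<forall>v\<in>unit_eigenvectors A. Delta A l b v u > 0)"
proof -
  define F where "F q R = Gamma_map \<theta> u (R, q)" for q R
  define E where "E = unit_eigenvectors A"
  define gap where "gap q R = V A (F q R) - Min ((\<lambda>p. V A (F p R)) ` Q)" for q R
  \<comment> \<open>The points that \<open>F q\<close> sends to half turns about eigenvectors;
    \<open>crit\<close> identifies them with the critical points away from the identity.\<close>
  define C where "C q = {R \<in> SO3. F q R \<in> Ra pi ` E}" for q
  have subm: "SO3_submersive (F q)" if "q \<in> Q" for q
    unfolding F_def using that u theta_diff Theta_det by (intro SO3_submersive_Gamma_map) auto
  have F_in: "F q R \<in> SO3" if "q \<in> Q" "R \<in> SO3" for q R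
    using SO3_submersive_in[OF subm] that by blast
  have F_1_iff: "F q R = mat 1 \<longleftrightarrow> R = mat 1" if "q \<in> Q" "R \<in> SO3" for q R
    using Gamma_preimage that by (auto simp: F_def)
  have E_unit: "norm v = 1" if "v \<in> E" for v
    using that by (simp add: E_def unit_eigenvectors_def)
  have half_turn_ne: "Ra pi v \<noteq> mat 1" if "v \<in> E" for v
  proof
    assume "Ra pi v = mat 1"
    then have "trace (Ra pi v) = 3" by (simp add: trace_I)
    then show False using E_unit[OF that] by (simp add: trace_Ra norm_eq_1)
  qed
  have "Q \<noteq> {}" using Q by auto
  have diff_Delta: "V A (F q R) - V A (F p R) = (1 - cos (\<theta> p R - \<theta> q R)) * Delta A l b v u"
    if v: "v \<in> E" and FqR: "F q R = Ra pi v" for p q R v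
  proof -
    obtain c where c: "A *v v = c *\<^sub>R v" using v by (auto simp: E_def unit_eigenvectors_def)
    have "F p R = Ra pi v ** Ra (\<theta> p R - \<theta> q R) u"
      using Gamma_map_index_change[OF u, of \<theta> R p q] FqR by (simp add: F_def)
    then show ?thesis
      using V_Ra_pi_diff[OF sym E_unit[OF v] c u] Delta_eq[OF eigenbasis u E_unit[OF v] c] FqR
      by simp
  qed
  have cont_V: "continuous_on SO3 (\<lambda>R. V A (F q R))" if "q \<in> Q" for q
    using V_SO3_submersive_derivative(1)[OF subm[OF that]]
    by (intro differentiable_imp_continuous_on) (simp add: differentiable_on_def)
  have potential: "(\<lambda>x. V A (Gamma_map \<theta> u x)) \<in> potential_functions Q ({mat 1} \<times> Q)"
  proof -
    have pos: "0 < V A (F q R)" if "q \<in> Q" "R \<in> SO3" "R \<noteq> mat 1" for q R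
      using that by (intro V_pos[OF sym W_pd]) (auto simp: F_in F_1_iff)
    have zero: "V A (F q (mat 1)) = 0" if "q \<in> Q" for q
      using F_1_iff[OF that mat_1_in_SO3] by (simp add: V_eq)
    have "0 \<le> V A (F q R)" if "q \<in> Q" "R \<in> SO3" for q R
      using pos[OF that] zero[OF that(1)] by (cases "R = mat 1") auto
    moreover have "(\<lambda>R. V A (F q R)) differentiable_on SO3" if "q \<in> Q" for q
      using V_SO3_submersive_derivative(1)[OF subm[OF that]] by (simp add: differentiable_on_def)
    ultimately show ?thesis
      using zero cont_V unfolding potential_functions_def F_def by (auto intro!: pos[unfolded F_def])
  qed
  \<comment> \<open>Removing \<open>mat 1\<close> from the critical points removes exactly those
    with \<open>F q R = mat 1\<close>, by the preimage hypothesis; a half turn is never the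
    identity.\<close>
  have crit: "critical_points Q (\<lambda>x. V A (Gamma_map \<theta> u x)) - {mat 1} \<times> Q = {(R, q). q \<in> Q \<and> R \<in> C q}"
  proof -
    have "grad_SO3 (\<lambda>R. V A (F q R)) R = 0 \<and> R \<noteq> mat 1 \<longleftrightarrow> F q R \<in> Ra pi ` E" if "q \<in> Q" "R \<in> SO3" for q R
    proof -
      have "grad_SO3 (\<lambda>R. V A (F q R)) R = 0 \<longleftrightarrow> F q R = mat 1 \<or> F q R \<in> Ra pi ` E"
        using V_SO3_submersive_derivative(2)[OF subm[OF that(1)] that(2)]
          symmetric_mult_SO3_iff[OF sym W_pd F_in[OF that]] by (auto simp: E_def)
      then show ?thesis
        using F_1_iff[OF that] half_turn_ne by (metis imageE)
    qed
    then show ?thesis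
      unfolding critical_points_def C_def F_def by auto
  qed
  have image: "(\<lambda>(R, q). V A (Gamma_map \<theta> u (R, q)) - Min ((\<lambda>p. V A (Gamma_map \<theta> u (R, p))) ` Q)) `
      {(R, q). q \<in> Q \<and> R \<in> C q} = (\<Union>q\<in>Q. gap q ` C q)"
    by (force simp: gap_def F_def)
  have syn: "synergistic Q (\<lambda>x. V A (Gamma_map \<theta> u x)) \<longleftrightarrow>
      (\<exists>\<delta>>0. \<exists>m. is_minimum m (\<Union>q\<in>Q. gap q ` C q) \<and> \<delta> < m)"
    using potential unfolding synergistic_def crit image by simp
  show ?thesis
    unfolding syn
  proof
    assume "\<exists>\<delta>>0. \<exists>m. is_minimum m (\<Union>q\<in>Q. gap q ` C q) \<and> \<delta> < m"
    then have gap_pos: "0 < gap q R" if "q \<in> Q" "R \<in> C q" for q R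
      using that by (fastforce simp: is_minimum_def)
    show "\<forall>v\<in>unit_eigenvectors A. Delta A l b v u > 0"
    proof
      fix v assume "v \<in> unit_eigenvectors A"
      then have v: "v \<in> E" by (simp add: E_def)
      obtain q where q: "q \<in> Q" using \<open>Q \<noteq> {}\<close> by blast
      obtain R where R: "R \<in> SO3" "F q R = Ra pi v"
        using SO3_submersive_surj[OF subm[OF q] Ra_in_SO3[OF E_unit[OF v]]] by blast
      then have "0 < gap q R" using gap_pos[OF q] v by (simp add: C_def)
      \<comment> \<open>An index \<open>p\<close> attaining the inner minimum writes the positive
        gap as a product with the nonnegative factor \<open>1 - cos\<close>, so the other factor is
        positive.\<close>
      moreover obtain p where "Min ((\<lambda>p. V A (F p R)) ` Q) = V A (F p R)"
        using Min_in[of "(\<lambda>p. V A (F p R)) ` Q"] Q(1) \<open>Q \<noteq> {}\<close> by blast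
      ultimately have "0 < (1 - cos (\<theta> p R - \<theta> q R)) * Delta A l b v u"
        using diff_Delta[OF v R(2)] by (simp add: gap_def)
      then show "Delta A l b v u > 0"
        using cos_le_one[of "\<theta> p R - \<theta> q R"] by (simp add: zero_less_mult_iff)
    qed
  next
    assume D: "\<forall>v\<in>unit_eigenvectors A. Delta A l b v u > 0"
    have gap_pos: "0 < gap q R" if q: "q \<in> Q" and R: "R \<in> C q" for q R
    proof -
      obtain v where v: "v \<in> E" "F q R = Ra pi v" and "R \<in> SO3"
        using R by (auto simp: C_def)
      \<comment> \<open>The angle hypothesis applies only away from the identity, where the preimage
        hypothesis forces every angle to be a multiple of \<open>2 * pi\<close>. Half turns do not
        occur at the identity.\<close>
      moreover have "R \<noteq> mat 1"
        using F_1_iff[OF q mat_1_in_SO3] half_turn_ne v by auto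
      moreover obtain p where p: "p \<in> Q" "p \<noteq> q"
        using Q(2) card_mono[of "{q}" Q] by force
      ultimately have "\<theta> p R - \<theta> q R \<noteq> 2 * pi * of_int k" for k :: int
        using theta_inj_angle q by blast
      then have "cos (\<theta> p R - \<theta> q R) \<noteq> 1"
        by (simp add: cos_one_2pi_int) (metis mult.assoc mult.commute)
      then have "cos (\<theta> p R - \<theta> q R) < 1"
        using cos_le_one[of "\<theta> p R - \<theta> q R"] by linarith
      then have "0 < V A (F q R) - V A (F p R)"
        unfolding diff_Delta[OF v] using D v(1) by (simp add: E_def)
      \<comment> \<open>Any second index bounds the inner minimum from above, so one index with a
        strictly smaller potential is enough.\<close>
      moreover have "Min ((\<lambda>p. V A (F p R)) ` Q) \<le> V A (F p R)"
        using Q p by simp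
      ultimately show ?thesis by (simp add: gap_def)
    qed
    \<comment> \<open>Pointwise positivity is not sufficient: \<open>synergistic\<close> asks for an
      attained minimum, which compactness of the set of gaps provides.\<close>
    have "compact (gap q ` C q)" if q: "q \<in> Q" for q
    proof (rule compact_continuous_image)
      have cont: "continuous_on SO3 (gap q)"
        unfolding gap_def using Q \<open>Q \<noteq> {}\<close> cont_V q
        by (intro continuous_on_diff continuous_on_Min) auto
      then show "continuous_on (C q) (gap q)"
        by (rule continuous_on_subset) (auto simp: C_def)
      have "compact (Ra pi ` E)"
        unfolding E_def by (intro compact_continuous_image continuous_on_Ra_axis compact_unit_eigenvectors)
      then have "closed (SO3 \<inter> F q -` (Ra pi ` E))"
        using SO3_submersive_continuous_on[OF subm[OF q]]
        by (intro continuous_closed_preimage compact_imp_closed compact_SO3)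
      moreover have "C q = SO3 \<inter> (SO3 \<inter> F q -` (Ra pi ` E))" by (auto simp: C_def)
      ultimately show "compact (C q)"
        using compact_Int_closed[OF compact_SO3] by metis
    qed
    then have "compact (\<Union>q\<in>Q. gap q ` C q)" using Q by (intro compact_UN) auto
    \<comment> \<open>The minimum also needs a critical point away from the identity; surjectivity
      of \<open>F q\<close> supplies one over the half turn about \<open>b 1\<close>.\<close>
    moreover have "(\<Union>q\<in>Q. gap q ` C q) \<noteq> {}"
    proof -
      obtain q where q: "q \<in> Q" using \<open>Q \<noteq> {}\<close> by blast
      have b: "b 1 \<in> E"
        using eigenbasis by (auto simp: E_def unit_eigenvectors_def labelled_eigenbasis_def norm_eq_1)
      obtain R where "R \<in> SO3" "F q R = Ra pi (b 1)"
        using SO3_submersive_surj[OF subm[OF q] Ra_in_SO3[OF E_unit[OF b]]] by blast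
      then show ?thesis using q b by (auto simp: C_def)
    qed
    ultimately have "\<exists>m. is_minimum m (\<Union>q\<in>Q. gap q ` C q)"
      unfolding is_minimum_def by (meson compact_attains_inf)
    then obtain m where m: "is_minimum m (\<Union>q\<in>Q. gap q ` C q)" ..
    then have "0 < m" using gap_pos by (auto simp: is_minimum_def)
    then show "\<exists>\<delta>>0. \<exists>m. is_minimum m (\<Union>q\<in>Q. gap q ` C q) \<and> \<delta> < m"
      using m by (intro exI[of _ "m / 2"]) auto
  qed
qed

end
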